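(* If $0<c<c^*$, then there is no monotone function $\phi\in C^2(\mathbb{R},\mathbb{R})$ satisfying $$\phi''(\xi)-c\,\phi'(\xi)-d\,\phi(\xi)+b\big(\phi(\xi-c\,\tau(\phi(\xi)))\big)=0,\qquad \xi\in\mathbb{R},$$ together with $$\lim_{\xi\to-\infty}\phi(\xi)=0,\qquad \lim_{\xi\to+\infty}\phi(\xi)=K.$$
   Context: Setting. $d>0$ is a constant. The birth function $b:[0,\infty)\to[0,\infty)$ satisfies, for some constant $K>0$: $b(0)=0$, $b(K)=dK$, $b(u)>du$ for $u\in(0,K)$, and $0<b(u)<du$ for $u>K$. The delay function $\tau:[0,\infty)\to[0,\infty)$ is $C^1$ on $[0,\infty)$, satisfies $0\le\tau'(u)<1$ for all $u\ge 0$, and $0\le m:=\tau(0)\le\lim_{u\to\infty}\tau(u)=:M<\infty$. Monotone birth function assumptions: $b$ is $C^1$ on $[0,K]$; $b'(0)>d$ and $b(u)<b'(0)u$ for $u\in(0,K]$; $0\le b'(u)\le b'(0)$ for $u\in[0,K]$; and there is $L>0$ such that $0\le b'(0)u-b(u)<Lu^2$ for $u\in(0,K]$. Definition of $c^*$. For $\lambda\ge0$, $c\ge0$ let $\Lambda(\lambda,c)=\lambda^2-c\lambda-d+b'(0)e^{-\lambda c m}$. Then $c^*>0$ is the constant such that $\Lambda(\lambda,c)>0$ for all $\lambda\ge0$ if $c\in[0,c^* )$, while for $c>c^*$ the equation $\Lambda(\lambda,c)=0$ has exactly two distinct positive real roots $\lambda_1(c)<\lambda_2(c)$, with $\Lambda(\cdot,c)<0$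 on $(\lambda_1(c),\lambda_2(c))$ and $\Lambda(\cdot,c)>0$ on $[0,\lambda_1(c))\cup(\lambda_2(c),\infty)$. *)

theory Defs
  imports "HOL-Analysis.Analysis"
begin

text \<open>
  The functions \<open>b\<close> and \<open>\<tau>\<close> live on \<open>[0,\<infinity>)\<close>; they are represented by total functions
  on the reals that are only constrained on \<open>{0..}\<close>. The derivative is an explicit argument
  \<open>f'\<close> and is taken within \<open>S\<close>, hence one-sided at the endpoints of an interval.
\<close>
definition C1_on :: "(real \<Rightarrow> real) \<Rightarrow> (real \<Rightarrow> real) \<Rightarrow> real set \<Rightarrow> bool" where
  "C1_on f f' S \<longleftrightarrow>
     (\<forall>x\<in>S. (f has_real_derivative f' x) (at x within S)) \<and> continuous_on S f'"

definition C2 :: "(real \<Rightarrow> real) \<Rightarrow> bool" where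
  "C2 f \<longleftrightarrow> (\<forall>x. f differentiable (at x)) \<and> (\<forall>x. deriv f differentiable (at x)) \<and>
     continuous_on UNIV (deriv (deriv f))"

definition birth_function :: "real \<Rightarrow> real \<Rightarrow> (real \<Rightarrow> real) \<Rightarrow> bool" where
  "birth_function d K b \<longleftrightarrow> (\<forall>u\<ge>0. b u \<ge> 0) \<and> b 0 = 0 \<and> b K = d * K \<and>
     (\<forall>u\<in>{0<..<K}. b u > d * u) \<and> (\<forall>u>K. 0 < b u \<and> b u < d * u)"

definition delay_function :: "(real \<Rightarrow> real) \<Rightarrow> (real \<Rightarrow> real) \<Rightarrow> real \<Rightarrow> real \<Rightarrow> bool" where
  "delay_function \<tau> \<tau>' m M \<longleftrightarrow> (\<forall>u\<ge>0. \<tau> u \<ge> 0) \<and> C1_on \<tau> \<tau>' {0..} \<and>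
     (\<forall>u\<ge>0. 0 \<le> \<tau>' u \<and> \<tau>' u < 1) \<and>
     m = \<tau> 0 \<and> (\<tau> \<longlongrightarrow> M) at_top \<and> 0 \<le> m \<and> m \<le> M"

definition monotone_birth :: "real \<Rightarrow> real \<Rightarrow> (real \<Rightarrow> real) \<Rightarrow> (real \<Rightarrow> real) \<Rightarrow> bool" where
  "monotone_birth d K b b' \<longleftrightarrow> C1_on b b' {0..K} \<and> b' 0 > d \<and>
     (\<forall>u\<in>{0<..K}. b u < b' 0 * u) \<and>
     (\<forall>u\<in>{0..K}. 0 \<le> b' u \<and> b' u \<le> b' 0) \<and>
     (\<exists>L>0. \<forall>u\<in>{0<..K}. 0 \<le> b' 0 * u - b u \<and> b' 0 * u - b u < L * u\<^sup>2)"

text \<open>The parameter \<open>p\<close> stands for \<open>b'(0)\<close>, and \<open>\<mu>\<close> for the variable \<open>\<lambda>\<close> of \<open>\<Lambda>(\<lambda>, c)\<close>.\<close>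
definition char_fun :: "real \<Rightarrow> real \<Rightarrow> real \<Rightarrow> real \<Rightarrow> real \<Rightarrow> real" where
  "char_fun d p m \<mu> c = \<mu>\<^sup>2 - c * \<mu> - d + p * exp (- \<mu> * c * m)"

definition is_critical_speed :: "real \<Rightarrow> real \<Rightarrow> real \<Rightarrow> real \<Rightarrow> bool" where
  "is_critical_speed d p m cs \<longleftrightarrow> cs > 0 \<and>
     (\<forall>c\<in>{0..<cs}. \<forall>\<mu>\<ge>0. char_fun d p m \<mu> c > 0) \<and>
     (\<forall>c>cs. \<exists>\<mu>1 \<mu>2. 0 < \<mu>1 \<and> \<mu>1 < \<mu>2 \<and>
        {\<mu>. 0 < \<mu> \<and> char_fun d p m \<mu> c = 0} = {\<mu>1, \<mu>2} \<and>
        (\<forall>\<mu>\<in>{\<mu>1<..<\<mu>2}. char_fun d p m \<mu> c < 0) \<and>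
        (\<forall>\<mu>\<in>{0..<\<mu>1} \<union> {\<mu>2<..}. char_fun d p m \<mu> c > 0))"

definition c_star :: "real \<Rightarrow> real \<Rightarrow> real \<Rightarrow> real" where
  "c_star d p m = (THE cs. is_critical_speed d p m cs)"

text \<open>
  The next lemmas show that \<open>c_star\<close> is well defined: under \<open>0 < d < p\<close> and \<open>0 \<le> m\<close>
  exactly one real number is a critical speed.
\<close>

lemma char_fun_strict_convex:
  assumes "p > 0" "x < y" "y < z"
  shows "(z - x) * char_fun d p m y c < (z - y) * char_fun d p m x c + (y - x) * char_fun d p m z c"
proof -
  define E where "E = (\<lambda>u::real. exp (- u * c * m))"
  have tan: "E y * (1 + (y - u) * c * m) \<le> E u" for u
  proof -
    have "E u = E y * exp ((y - u) * c * m)"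
      unfolding E_def by (simp add: exp_add[symmetric] algebra_simps)
    moreover have "1 + (y - u) * c * m \<le> exp ((y - u) * c * m)" by (rule exp_ge_add_one_self)
    moreover have "E y > 0" by (simp add: E_def)
    ultimately show ?thesis by simp
  qed
  have "(z - y) * (E y * (1 + (y - x) * c * m)) \<le> (z - y) * E x"
       "(y - x) * (E y * (1 + (y - z) * c * m)) \<le> (y - x) * E z"
    using tan assms by (auto intro!: mult_left_mono)
  then have "(z - y) * (E y * (1 + (y - x) * c * m)) + (y - x) * (E y * (1 + (y - z) * c * m))
      \<le> (z - y) * E x + (y - x) * E z" by linarith
  then have "(z - x) * E y \<le> (z - y) * E x + (y - x) * E z"
    by (simp add: algebra_simps)
  then have "p * ((z - x) * E y) \<le> p * ((z - y) * E x + (y - x) * E z)"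
    using assms by (intro mult_left_mono) auto
  moreover have "(z - y) * x\<^sup>2 + (y - x) * z\<^sup>2 - (z - x) * y\<^sup>2 = (z - y) * (y - x) * (z - x)"
    by (simp add: algebra_simps power2_eq_square)
  moreover have "(z - y) * (y - x) * (z - x) > 0" using assms by simp
  moreover have cf: "char_fun d p m u c = u\<^sup>2 - c * u - d + p * E u" for u
    by (simp add: char_fun_def E_def)
  have "(z - y) * char_fun d p m x c + (y - x) * char_fun d p m z c - (z - x) * char_fun d p m y c
     = ((z - y) * x\<^sup>2 + (y - x) * z\<^sup>2 - (z - x) * y\<^sup>2)
       + (p * ((z - y) * E x + (y - x) * E z) - p * ((z - x) * E y))"
    unfolding cf by (simp add: algebra_simps)
  ultimately show ?thesis by linarith
qed

lemma char_fun_speed_mono: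
  assumes "p > 0" "m \<ge> 0" "0 \<le> l" "c \<le> c'"
  shows "char_fun d p m l c' \<le> char_fun d p m l c"
    and "0 < l \<Longrightarrow> c < c' \<Longrightarrow> char_fun d p m l c' < char_fun d p m l c"
proof -
  have "l * c * m \<le> l * c' * m" using assms by (intro mult_right_mono mult_left_mono) auto
  then have e: "p * exp (- l * c' * m) \<le> p * exp (- l * c * m)" using assms by simp
  have "c * l \<le> c' * l" using assms by (intro mult_right_mono) auto
  then show "char_fun d p m l c' \<le> char_fun d p m l c"
    using e by (simp add: char_fun_def)
  assume "0 < l" "c < c'"
  then have "c * l < c' * l" by simp
  then show "char_fun d p m l c' < char_fun d p m l c"
    using e by (simp add: char_fun_def)
qed

lemma char_fun_two_roots:
  assumes p: "0 < d" "d < p" and l0: "l0 > 0" "char_fun d p m l0 c < 0" and c: "c \<ge> 0"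
  shows "\<exists>\<mu>1 \<mu>2. 0 < \<mu>1 \<and> \<mu>1 < \<mu>2 \<and>
        {\<mu>. 0 < \<mu> \<and> char_fun d p m \<mu> c = 0} = {\<mu>1, \<mu>2} \<and>
        (\<forall>\<mu>\<in>{\<mu>1<..<\<mu>2}. char_fun d p m \<mu> c < 0) \<and>
        (\<forall>\<mu>\<in>{0..<\<mu>1} \<union> {\<mu>2<..}. char_fun d p m \<mu> c > 0)"
proof -
  define f where "f = (\<lambda>l. char_fun d p m l c)"
  have cont: "continuous_on A f" for A
    unfolding f_def char_fun_def by (intro continuous_intros)
  have f0: "f 0 > 0" using p by (simp add: f_def char_fun_def)
  define R where "R = l0 + c + d + 1"
  have R: "R > l0" "R \<ge> 1" "R - c \<ge> d" using l0 c p by (auto simp: R_def)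
  have "R * (R - c) \<ge> 1 * d" using R p by (intro mult_mono) auto
  moreover have "p * exp (- R * c * m) > 0" using p by simp
  ultimately have fR: "f R > 0"
    by (simp add: f_def char_fun_def power2_eq_square algebra_simps)
  obtain a where a: "0 \<le> a" "a \<le> l0" "f a = 0"
    using IVT2'[of f l0 0 0] cont f0 l0 by (auto simp: f_def)
  obtain e where e: "l0 \<le> e" "e \<le> R" "f e = 0"
    using IVT'[of f l0 0 R] cont fR l0 R by (auto simp: f_def)
  have ne: "a \<noteq> 0" "a \<noteq> l0" "e \<noteq> l0" using a e f0 l0 by (auto simp: f_def)
  then have ord: "0 < a" "a < e" using a e by auto
  have conv: "(z - x) * f y < (z - y) * f x + (y - x) * f z" if "x < y" "y < z" for x y z
    unfolding f_def using char_fun_strict_convex that p by simp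
  have mid: "f l < 0" if "a < l" "l < e" for l
    using conv[of a l e] that a e by (simp add: mult_less_0_iff)
  have left: "f l > 0" if "l < a" for l
    using conv[of l a e] that a e ord by (simp add: zero_less_mult_iff)
  have right: "f l > 0" if "e < l" for l
    using conv[of a e l] that a e ord by (simp add: zero_less_mult_iff)
  have "{l. 0 < l \<and> f l = 0} = {a, e}"
    using mid left right ord a e by (auto, metis less_irrefl linorder_neqE_linordered_idom)
  then show ?thesis
    using ord mid left right unfolding f_def by (intro exI[of _ a] exI[of _ e]) auto
qed

lemma critical_speed_exists:
  assumes p: "0 < d" "d < p" and m: "0 \<le> m"
  shows "\<exists>cs. is_critical_speed d p m cs"
proof -
  define A where "A = {c. 0 \<le> c \<and> (\<forall>l\<ge>0. char_fun d p m l c > 0)}"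
  define B where "B = 1 + p"
  have bound: "c \<le> B" if "c \<in> A" for c
  proof -
    have "c \<ge> 0" "char_fun d p m 1 c > 0" using that by (auto simp: A_def)
    moreover have "exp (- c * m) \<le> 1" using m \<open>c \<ge> 0\<close> by simp
    then have "p * exp (- c * m) \<le> p * 1" using p by (intro mult_left_mono) auto
    moreover have "char_fun d p m 1 c = 1 - c - d + p * exp (- c * m)"
      by (simp add: char_fun_def)
    ultimately show ?thesis using p unfolding B_def by linarith
  qed
  then have bdd: "bdd_above A" by (auto simp: bdd_above_def)
  define c0 where "c0 = sqrt (p - d) / (1 + p * m)"
  have pm: "1 + p * m > 0" using p m by (simp add: add_pos_nonneg)
  have c0: "c0 > 0" using p pm by (simp add: c0_def)
  have "c0 \<in> A"
  proof -
    have "char_fun d p m l c0 > 0" if "l \<ge> 0" for l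
    proof -
      have "1 + (- l * c0 * m) \<le> exp (- l * c0 * m)" by (rule exp_ge_add_one_self)
      then have "p * (1 + (- l * c0 * m)) \<le> p * exp (- l * c0 * m)"
        using p by (intro mult_left_mono) auto
      then have "char_fun d p m l c0 \<ge> l\<^sup>2 - c0 * (1 + p * m) * l + (p - d)"
        by (simp add: char_fun_def algebra_simps)
      moreover have "c0 * (1 + p * m) = sqrt (p - d)" using pm by (simp add: c0_def)
      moreover have "l\<^sup>2 - sqrt (p - d) * l + (p - d) = (l - sqrt (p - d) / 2)\<^sup>2 + 3/4 * (sqrt (p - d))\<^sup>2"
        using p by (simp add: power2_eq_square field_simps)
      moreover have "c0 * (1 + p * m) * l = sqrt (p - d) * l"
        using pm by (simp add: c0_def)
      moreover have "(sqrt (p - d))\<^sup>2 > 0" using p by simp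
      moreover have "(l - sqrt (p - d) / 2)\<^sup>2 \<ge> 0" by simp
      ultimately show ?thesis by linarith
    qed
    then show ?thesis using c0 by (simp add: A_def)
  qed
  define cs where "cs = Sup A"
  have pos: "cs > 0" using cSup_upper[OF \<open>c0 \<in> A\<close> bdd] c0 by (simp add: cs_def)
  have below: "char_fun d p m l c > 0" if "0 \<le> c" "c < cs" "l \<ge> 0" for c l
  proof -
    obtain c' where "c' \<in> A" "c < c'"
      using less_cSup_iff[of A c] \<open>c0 \<in> A\<close> bdd \<open>c < cs\<close> unfolding cs_def by blast
    then show ?thesis
      using char_fun_speed_mono(1)[of p m l c c' d] that p m by (force simp: A_def)
  qed
  have above: "\<exists>l>0. char_fun d p m l c < 0" if "c > cs" for c
  proof -
    define c' where "c' = (cs + c) / 2"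
    have c': "cs < c'" "c' < c" using that by (auto simp: c'_def)
    then have "c' \<notin> A" using cSup_upper[OF _ bdd, of c'] by (auto simp: cs_def)
    then obtain l where l: "l \<ge> 0" "char_fun d p m l c' \<le> 0"
      using c' pos by (auto simp: A_def not_less)
    then have "l \<noteq> 0" using p by (auto simp: char_fun_def)
    then show ?thesis
      using l c' char_fun_speed_mono(2)[of p m l c' c d] p m
      by (intro exI[of _ l]) auto
  qed
  have "is_critical_speed d p m cs"
    unfolding is_critical_speed_def
  proof (intro conjI ballI allI impI pos)
    show "char_fun d p m l c > 0" if "c \<in> {0..<cs}" "0 \<le> l" for c l
      using below that by simp
  next
    fix c assume "cs < c"
    then obtain l where "l > 0" "char_fun d p m l c < 0" using above by blast
    then show "\<exists>\<mu>1 \<mu>2. 0 < \<mu>1 \<and> \<mu>1 < \<mu>2 \<and>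
        {\<mu>. 0 < \<mu> \<and> char_fun d p m \<mu> c = 0} = {\<mu>1, \<mu>2} \<and>
        (\<forall>\<mu>\<in>{\<mu>1<..<\<mu>2}. char_fun d p m \<mu> c < 0) \<and>
        (\<forall>\<mu>\<in>{0..<\<mu>1} \<union> {\<mu>2<..}. char_fun d p m \<mu> c > 0)"
      using pos \<open>cs < c\<close> p by (intro char_fun_two_roots) auto
  qed
  then show ?thesis ..
qed

lemma critical_speed_unique:
  assumes "is_critical_speed d p m a" "is_critical_speed d p m e"
  shows "a = e"
proof -
  have False if h: "is_critical_speed d p m x" "is_critical_speed d p m y" "x < y" for x y
  proof -
    define c where "c = (x + y) / 2"
    have c: "x < c" "c < y" "0 \<le> c" using h by (auto simp: c_def is_critical_speed_def)
    from h(1) c obtain \<mu>1 \<mu>2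
      where r: "0 < \<mu>1" "{\<mu>. 0 < \<mu> \<and> char_fun d p m \<mu> c = 0} = {\<mu>1, \<mu>2}"
      unfolding is_critical_speed_def by blast
    then have "char_fun d p m \<mu>1 c = 0" by blast
    moreover have "char_fun d p m \<mu>1 c > 0"
      using h(2) c r(1) unfolding is_critical_speed_def by auto
    ultimately show False by simp
  qed
  then show ?thesis using assms by (metis linorder_neqE_linordered_idom)
qed

lemma is_critical_speed_c_star:
  assumes "0 < d" "d < p" "0 \<le> m"
  shows "is_critical_speed d p m (c_star d p m)"
  unfolding c_star_def
  using critical_speed_exists[OF assms] critical_speed_unique by (blast intro: theI)

end

theory Submission
  imports Defs
begin

text \<open>
  Let \<open>\<phi>\<close> be a nondecreasing profile. As \<open>b \<ge> 0\<close>, we have \<open>\<phi>'' \<le> c \<phi>' + d \<phi>\<close>, which bounds the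
  logarithmic derivative \<open>r = \<phi>' / \<phi>\<close> by the positive root of \<open>\<rho>\<^sup>2 - c \<rho> - d\<close>. Let
  \<open>S \<ge> 0\<close> be the upper limit of \<open>r\<close> at \<open>-\<infinity>\<close>. Near \<open>-\<infinity>\<close> the delayed term is at least about
  \<open>b'(0) \<phi>(\<xi> - c m) \<ge> b'(0) exp (- S c m) \<phi>(\<xi>)\<close>, so the Riccati inequality
  \<open>r' \<le> - (r\<^sup>2 - c r - d + b'(0) exp (- S c m))\<close> holds up to small errors. Where \<open>r\<close> is close to
  \<open>S\<close>, the right-hand side is close to \<open>- \<Lambda>(S, c) < 0\<close>; hence, followed to the left from a point
  where it is close to \<open>S\<close>, \<open>r\<close> grows without bound, a contradiction.
\<close>

section \<open>Backward estimates from differential inequalities\<close>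

lemma unbounded_backward:
  fixes r r' :: "real \<Rightarrow> real"
  assumes der: "\<And>x. x \<le> x0 \<Longrightarrow> (r has_real_derivative r' x) (at x)"
    and start: "a < r x0" and "\<delta> > 0"
    and dec: "\<And>x. x \<le> x0 \<Longrightarrow> a \<le> r x \<Longrightarrow> r' x \<le> - \<delta>"
  shows "\<exists>x\<le>x0. B < r x"
proof -
  have cont: "continuous_on {x..x0} r" for x
    by (rule DERIV_continuous_on[where D = r']) (auto intro: DERIV_subset[OF der])
  \<comment> \<open>If \<open>r\<close> were below \<open>a\<close> somewhere, there would be a last
    crossing \<open>z\<close> of level \<open>a\<close> before \<open>x0\<close>. But
    \<open>r\<close> decreases at \<open>z\<close>, so it drops below \<open>a\<close> just to the
    right and has to cross once more.\<close>
  have above: "a \<le> r x" if "x \<le> x0" for x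
  proof (rule ccontr)
    assume "\<not> a \<le> r x"
    define Z where "Z = {y \<in> {x..x0}. r y = a}"
    obtain y where "x \<le> y" "y \<le> x0" "r y = a"
      using IVT'[of r x a x0] cont \<open>x \<le> x0\<close> start \<open>\<not> a \<le> r x\<close> by auto
    then have "Z \<noteq> {}" by (auto simp: Z_def)
    moreover have "compact Z"
    proof -
      have "Z = {x..x0} \<inter> r -` {a}" by (auto simp: Z_def)
      then have "closed Z" using continuous_closed_preimage[OF cont] by simp
      then show ?thesis
        by (auto simp: compact_eq_bounded_closed Z_def intro: bounded_subset[of "{x..x0}"])
    qed
    ultimately obtain z where z: "z \<in> Z" "\<And>y. y \<in> Z \<Longrightarrow> y \<le> z"
      using compact_attains_sup by metis
    then have zx: "x \<le> z" "z < x0" "r z = a" using start by (auto simp: Z_def less_le)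
    have "r' z < 0" using dec[of z] zx \<open>\<delta> > 0\<close> by auto
    then obtain e where e: "e > 0" "\<And>h. 0 < h \<Longrightarrow> h < e \<Longrightarrow> r (z + h) < r z"
      using DERIV_neg_dec_right[OF der[of z]] zx by auto
    define y where "y = z + min (e / 2) (x0 - z)"
    have y: "z < y" "y \<le> x0" "r y < a"
      using e zx by (auto simp: y_def min_def)
    then obtain w where "y \<le> w" "w \<le> x0" "r w = a"
      using IVT'[of r y a x0] cont start by auto
    then have "w \<in> Z" using y zx by (auto simp: Z_def)
    then show False using z(2)[of w] y \<open>y \<le> w\<close> by simp
  qed
  \<comment> \<open>Going back by \<open>t\<close> raises \<open>r\<close> by at least
    \<open>\<delta> * t\<close>, which takes it from above \<open>a\<close> to above
    \<open>B\<close>.\<close>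
  define t where "t = (\<bar>B\<bar> + \<bar>a\<bar> + 1) / \<delta>"
  have t: "t > 0" using \<open>\<delta> > 0\<close> by (simp add: t_def add_nonneg_pos)
  have "\<exists>z. x0 - t < z \<and> z < x0 \<and> r x0 - r (x0 - t) = (x0 - (x0 - t)) * r' z"
    by (rule MVT2) (use t der in auto)
  then obtain z where z: "z < x0" "r x0 - r (x0 - t) = t * r' z" by auto
  have "t * r' z \<le> t * (- \<delta>)"
    using dec[of z] above[of z] z t by (intro mult_left_mono) auto
  also have "\<dots> = - (\<bar>B\<bar> + \<bar>a\<bar> + 1)" using \<open>\<delta> > 0\<close> by (simp add: t_def)
  finally have "B < r (x0 - t)" using z start by linarith
  then show ?thesis using t by (intro exI[of _ "x0 - t"]) auto
qed

text \<open>Gronwall's argument: multiplying by the integrating factor makes \<open>f\<close>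
  nonincreasing. As \<open>f\<close> and \<open>s\<close> may have any sign, this serves both the
  profile and the auxiliary \<open>w\<close> with rate \<open>c - \<rho>\<close>.\<close>

lemma exp_growth_bound:
  fixes f f' :: "real \<Rightarrow> real"
  assumes "x \<le> y" and der: "\<And>z. z \<le> y \<Longrightarrow> (f has_real_derivative f' z) (at z)"
    and le: "\<And>z. z \<le> y \<Longrightarrow> f' z \<le> s * f z"
  shows "f y * exp (- s * (y - x)) \<le> f x"
proof -
  define g where "g = (\<lambda>z. f z * exp (- s * (z - x)))"
  have "\<exists>D. (g has_real_derivative D) (at z) \<and> D \<le> 0" if "z \<le> y" for z
  proof (intro exI conjI)
    show "(g has_real_derivative (f' z - s * f z) * exp (- s * (z - x))) (at z)"
      unfolding g_def using der[OF that]
      by (auto intro!: derivative_eq_intros simp: algebra_simps)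
    show "(f' z - s * f z) * exp (- s * (z - x)) \<le> 0"
      using le[OF that] by (simp add: mult_nonpos_nonneg)
  qed
  then have "g y \<le> g x" using DERIV_nonpos_imp_nonincreasing[OF \<open>x \<le> y\<close>] by blast
  then show ?thesis by (simp add: g_def)
qed

text \<open>With \<open>w = \<phi>' - \<rho> \<phi>\<close>, the hypothesis says \<open>w' \<le> (c - \<rho>) w\<close>, where \<open>c - \<rho> \<le> 0\<close> is the other
  root. A positive value of \<open>w\<close> would thus keep \<open>\<phi>'\<close> away from \<open>0\<close> on a left half-line.\<close>
lemma log_derivative_bound:
  fixes f f' f'' :: "real \<Rightarrow> real"
  assumes der: "\<And>x. (f has_real_derivative f' x) (at x)"
      "\<And>x. (f' has_real_derivative f'' x) (at x)"
    and le: "\<And>x. f'' x \<le> c * f' x + d * f x"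
    and nonneg: "\<And>x. 0 \<le> f x"
    and \<rho>: "\<rho> > 0" "\<rho> \<ge> c" "\<rho>\<^sup>2 = c * \<rho> + d"
  shows "f' x \<le> \<rho> * f x"
proof (rule ccontr)
  assume "\<not> f' x \<le> \<rho> * f x"
  define w where "w = (\<lambda>x. f' x - \<rho> * f x)"
  have wx: "w x > 0" using \<open>\<not> _\<close> by (simp add: w_def)
  have wd: "(w has_real_derivative (f'' z - \<rho> * f' z)) (at z)" for z
    unfolding w_def by (auto intro!: derivative_eq_intros der)
  have wle: "f'' z - \<rho> * f' z \<le> (c - \<rho>) * w z" for z
  proof -
    have "(c - \<rho>) * w z = c * f' z - \<rho> * f' z + (\<rho>\<^sup>2 - c * \<rho>) * f z"
      by (simp add: w_def algebra_simps power2_eq_square)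
    then show ?thesis using le[of z] \<rho>(3) by simp
  qed
  have low: "w x \<le> f' y" if "y \<le> x" for y
  proof -
    have "w x * exp (- (c - \<rho>) * (x - y)) \<le> w y"
      by (rule exp_growth_bound[OF that wd wle])
    moreover have "w x * 1 \<le> w x * exp (- (c - \<rho>) * (x - y))"
      using wx that \<rho> by (intro mult_left_mono) (auto intro: mult_nonpos_nonneg)
    moreover have "w y \<le> f' y" using \<rho> nonneg[of y] by (simp add: w_def)
    ultimately show ?thesis by linarith
  qed
  \<comment> \<open>With slope at least \<open>w x\<close>, going back by this length forces
    \<open>f (x - t) \<le> -1\<close>.\<close>
  define t where "t = (f x + 1) / w x"
  have t: "t > 0" using nonneg[of x] wx by (simp add: t_def)
  have "\<exists>z. x - t < z \<and> z < x \<and> f x - f (x - t) = (x - (x - t)) * f' z"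
    by (rule MVT2) (use t der in auto)
  then obtain z where z: "z < x" "f x - f (x - t) = t * f' z" by auto
  have "t * w x \<le> t * f' z" using low[of z] z t by (intro mult_left_mono) auto
  moreover have "t * w x = f x + 1" using wx by (simp add: t_def)
  ultimately show False using z(2) nonneg[of "x - t"] by linarith
qed

text \<open>\<open>S\<close> is the infimum of the eventual upper bounds. Being a lower bound of
  them, it is approached from below frequently, which later supplies the starting point
  \<open>x0\<close>.\<close>

lemma limsup_at_bot_exists:
  fixes r :: "real \<Rightarrow> real"
  assumes "\<And>x. 0 \<le> r x" "\<And>x. r x \<le> B"
  obtains S where "0 \<le> S" "\<And>e. e > 0 \<Longrightarrow> \<forall>\<^sub>F x in at_bot. r x \<le> S + e"
    "\<And>e. e > 0 \<Longrightarrow> \<exists>\<^sub>F x in at_bot. S - e < r x"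
proof -
  define A where "A = {s. \<forall>\<^sub>F x in at_bot. r x \<le> s}"
  have ne: "B \<in> A" using assms by (simp add: A_def)
  have pos: "0 \<le> s" if "s \<in> A" for s
  proof -
    obtain x where "r x \<le> s"
      using \<open>s \<in> A\<close> eventually_happens[of "\<lambda>x. r x \<le> s" at_bot] by (auto simp: A_def)
    then show ?thesis using assms(1)[of x] by linarith
  qed
  then have bdd: "bdd_below A" by (auto simp: bdd_below_def)
  show thesis
  proof (rule that[of "Inf A"])
    show "0 \<le> Inf A" using ne pos by (intro cInf_greatest) auto
  next
    fix e :: real assume "e > 0"
    then obtain s where "s \<in> A" "s < Inf A + e"
      using cInf_less_iff[of A "Inf A + e"] ne bdd by auto
    then show "\<forall>\<^sub>F x in at_bot. r x \<le> Inf A + e"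
      by (auto simp: A_def elim!: eventually_mono)
  next
    fix e :: real assume "e > 0"
    then have "Inf A - e \<notin> A" using cInf_lower[OF _ bdd, of "Inf A - e"] by auto
    then show "\<exists>\<^sub>F x in at_bot. Inf A - e < r x"
      by (simp add: A_def not_eventually not_le)
  qed
qed

section \<open>Nonexistence of nondecreasing profiles\<close>

lemma no_mono_profile:
  fixes \<phi> \<phi>' \<phi>'' b \<tau> :: "real \<Rightarrow> real"
  assumes "d > 0" "K > 0" "0 < c" "0 \<le> m" "0 < p"
    and \<tau>: "\<tau> 0 = m" "continuous_on {0..} \<tau>" "\<And>u. u \<ge> 0 \<Longrightarrow> \<tau> u \<ge> 0"
    and b: "\<And>u. u \<ge> 0 \<Longrightarrow> b u \<ge> 0"
      "\<And>u. 0 < u \<Longrightarrow> u \<le> K \<Longrightarrow> p * u - b u \<le> L * u\<^sup>2"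
    and char: "\<And>s. s \<ge> 0 \<Longrightarrow> char_fun d p m s c > 0"
    and der: "\<And>x. (\<phi> has_real_derivative \<phi>' x) (at x)"
      "\<And>x. (\<phi>' has_real_derivative \<phi>'' x) (at x)"
    and "mono \<phi>"
    and eq: "\<And>x. \<phi>'' x - c * \<phi>' x - d * \<phi> x + b (\<phi> (x - c * \<tau> (\<phi> x))) = 0"
    and lim: "(\<phi> \<longlongrightarrow> 0) at_bot" "(\<phi> \<longlongrightarrow> K) at_top"
  shows False
proof -
  have nonneg: "0 \<le> \<phi> x" for x
    using lim(1) by (rule tendsto_upperbound)
      (auto intro!: eventually_mono[OF eventually_le_at_bot[of x]] monoD[OF \<open>mono \<phi>\<close>])
  have \<phi>K: "\<phi> x \<le> K" for x
    using lim(2) by (rule tendsto_lowerbound)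
      (auto intro!: eventually_mono[OF eventually_ge_at_top[of x]] monoD[OF \<open>mono \<phi>\<close>])
  define \<rho> where "\<rho> = (c + sqrt (c\<^sup>2 + 4 * d)) / 2"
  have "sqrt (c\<^sup>2 + 4 * d) \<ge> c" using assms by (intro real_le_rsqrt) auto
  then have \<rho>1: "\<rho> > 0" "\<rho> \<ge> c" using \<open>c > 0\<close> by (auto simp: \<rho>_def)
  have "(sqrt (c\<^sup>2 + 4 * d))\<^sup>2 = c\<^sup>2 + 4 * d" using \<open>d > 0\<close> by simp
  then have \<rho>2: "\<rho>\<^sup>2 = c * \<rho> + d"
    by (simp add: \<rho>_def power2_eq_square algebra_simps)
  have \<phi>'': "\<phi>'' x \<le> c * \<phi>' x + d * \<phi> x" for x
    using eq[of x] b(1)[OF nonneg[of "x - c * \<tau> (\<phi> x)"]] by linarith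
  have bound: "\<phi>' x \<le> \<rho> * \<phi> x" for x
    by (rule log_derivative_bound[OF der \<phi>'' nonneg \<rho>1 \<rho>2])
  \<comment> \<open>A zero would propagate to the right by the growth bound, against the limit
    \<open>K > 0\<close>.\<close>
  have pos: "\<phi> x > 0" for x
  proof (rule ccontr)
    assume "\<not> \<phi> x > 0"
    then have "\<phi> x = 0" using nonneg[of x] by simp
    then have "\<phi> y \<le> 0" if "y \<ge> x" for y
      using exp_growth_bound[OF that der(1) bound] by (simp add: mult_le_0_iff)
    then have "K \<le> 0"
      by (intro tendsto_upperbound[OF lim(2)]) (auto simp: eventually_at_top_linorder)
    then show False using \<open>K > 0\<close> by simp
  qed
  have \<phi>'0: "\<phi>' x \<ge> 0" for x
    by (rule mono_on_imp_deriv_nonneg[OF \<open>mono \<phi>\<close> der(1)]) simp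
  define r where "r = (\<lambda>x. \<phi>' x / \<phi> x)"
  define r' where "r' = (\<lambda>x. \<phi>'' x / \<phi> x - (r x)\<^sup>2)"
  have rder: "(r has_real_derivative r' x) (at x)" for x
    unfolding r_def r'_def using pos[of x]
    by (auto intro!: derivative_eq_intros der simp: field_simps power2_eq_square)
  have "0 \<le> r x" "r x \<le> \<rho>" for x
    using pos[of x] bound[of x] \<phi>'0[of x] by (auto simp: r_def field_simps)
  then obtain S where S: "0 \<le> S" "\<And>e. e > 0 \<Longrightarrow> \<forall>\<^sub>F x in at_bot. r x \<le> S + e"
    "\<And>e. e > 0 \<Longrightarrow> \<exists>\<^sub>F x in at_bot. S - e < r x"
    by (rule limsup_at_bot_exists[of r \<rho>]) blast+
  \<comment> \<open>\<open>H e\<close> collects the errors for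
    \<open>S - e \<le> r \<le> S + e\<close>, delay at most \<open>m + e\<close> and
    \<open>b u \<ge> (p - e) * u\<close>. Since \<open>H 0\<close> is the characteristic function at
    \<open>S\<close>, continuity yields a usable \<open>e\<close>.\<close>
  define H where "H = (\<lambda>e. S\<^sup>2 - 2 * S * e - c * S - c * e - d
      + (p - e) * exp (- (S + e) * (c * (m + e))))"
  have "isCont H 0" unfolding H_def by (intro continuous_intros)
  then have "(H \<longlongrightarrow> H 0) (at_right 0)"
    by (simp add: isCont_def filterlim_at_split)
  moreover have "H 0 > 0"
    using char[OF S(1)] by (simp add: H_def char_fun_def mult.assoc)
  ultimately have "\<forall>\<^sub>F e in at_right 0. H e > 0" by (rule order_tendstoD)
  moreover have "\<forall>\<^sub>F e in at_right 0. e \<in> {0<..<p}"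
    using \<open>0 < p\<close> by (rule eventually_at_right_real)
  ultimately obtain e where e: "H e > 0" "0 < e" "e < p"
    using eventually_happens'[OF _ eventually_conj] by (metis (no_types, lifting)
        greaterThanLessThan_iff trivial_limit_at_right_real)
  have "\<forall>\<^sub>F x in at_bot. \<tau> (\<phi> x) < m + e"
  proof -
    have "(\<tau> \<longlongrightarrow> m) (at 0 within {0..})"
      using \<tau> by (auto simp: continuous_on_def)
    \<comment> \<open>Continuity of \<open>\<tau>\<close> at 0 is one-sided; positivity of
      \<open>\<phi>\<close> keeps it inside the punctured one-sided neighbourhood.\<close>
    moreover have "filterlim \<phi> (at 0 within {0..}) at_bot"
      using lim(1) pos nonneg
      by (simp add: filterlim_at less_imp_neq[symmetric] eventually_at_bot_linorder)
    ultimately have "((\<lambda>x. \<tau> (\<phi> x)) \<longlongrightarrow> m) at_bot" by (rule filterlim_compose)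
    then show ?thesis using e by (intro order_tendstoD) auto
  qed
  moreover have "\<forall>\<^sub>F x in at_bot. L * \<phi> x < e"
    using tendsto_mult[OF tendsto_const[of L] lim(1)] e by (intro order_tendstoD) auto
  moreover note S(2)[OF e(2)]
  ultimately have "\<forall>\<^sub>F x in at_bot. \<tau> (\<phi> x) < m + e \<and> L * \<phi> x < e \<and> r x \<le> S + e"
    by eventually_elim auto
  then obtain X where X: "\<And>x. x \<le> X \<Longrightarrow> \<tau> (\<phi> x) < m + e"
      "\<And>x. x \<le> X \<Longrightarrow> L * \<phi> x < e" "\<And>x. x \<le> X \<Longrightarrow> r x \<le> S + e"
    by (auto simp: eventually_at_bot_linorder)
  obtain x0 where x0: "x0 \<le> X" "S - e < r x0"
    using frequently_eventually_frequently[OF S(3)[OF e(2)] eventually_le_at_bot[of X]]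
    by (auto dest: frequently_ex)
  have r'_le: "r' x \<le> - H e" if "x \<le> X" "S - e \<le> r x" for x
  proof -
    define y where "y = x - c * \<tau> (\<phi> x)"
    define h where "h = c * (m + e)"
    have h: "h > 0" using \<open>c > 0\<close> \<open>0 \<le> m\<close> e by (simp add: h_def)
    have "c * \<tau> (\<phi> x) \<le> h"
      unfolding h_def using X(1)[OF that(1)] \<open>c > 0\<close> by (intro mult_left_mono) auto
    then have "x - h \<le> y" by (simp add: y_def)
    have "\<phi>' z \<le> (S + e) * \<phi> z" if "z \<le> x" for z
      using X(3)[of z] pos[of z] that \<open>x \<le> X\<close> by (simp add: r_def field_simps)
    \<comment> \<open>Monotonicity replaces the state-dependent delay by its upper bound
      \<open>h\<close>; the growth rate \<open>S + e\<close> then compares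
      \<open>\<phi> (x - h)\<close> with \<open>\<phi> x\<close>.\<close>
    then have "\<phi> x * exp (- (S + e) * (x - (x - h))) \<le> \<phi> (x - h)"
      using h by (intro exp_growth_bound[OF _ der(1)]) auto
    also have "\<dots> \<le> \<phi> y" using \<open>x - h \<le> y\<close> by (rule monoD[OF \<open>mono \<phi>\<close>])
    finally have \<phi>y: "\<phi> x * exp (- (S + e) * h) \<le> \<phi> y" by simp
    have by_low: "(p - e) * \<phi> y \<le> b (\<phi> y)"
    proof -
      have "0 \<le> c * \<tau> (\<phi> x)" using \<tau>(3)[OF nonneg] \<open>c > 0\<close> by simp
      then have "y \<le> X" using \<open>x \<le> X\<close> by (simp add: y_def)
      then have "L * \<phi> y * \<phi> y \<le> e * \<phi> y"
        using X(2)[of y] pos[of y] by (intro mult_right_mono) auto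
      then show ?thesis
        using b(2)[OF pos \<phi>K, of y] by (simp add: algebra_simps power2_eq_square)
    qed
    have "(p - e) * (\<phi> x * exp (- (S + e) * h)) \<le> (p - e) * \<phi> y"
      using \<phi>y e by (intro mult_left_mono) auto
    then have "\<phi>'' x \<le> c * \<phi>' x + d * \<phi> x - (p - e) * (\<phi> x * exp (- (S + e) * h))"
      using eq[of x] by_low unfolding y_def by linarith
    then have "\<phi>'' x / \<phi> x \<le> (c * \<phi>' x + d * \<phi> x - (p - e) * (\<phi> x * exp (- (S + e) * h))) / \<phi> x"
      using pos[of x] by (intro divide_right_mono) auto
    also have "\<dots> = c * r x + d - (p - e) * exp (- (S + e) * h)"
      using pos[of x] by (simp add: r_def add_divide_distrib diff_divide_distrib)
    finally have "r' x \<le> - ((r x)\<^sup>2 - c * r x - d + (p - e) * exp (- (S + e) * h))"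
      by (simp add: r'_def)
    moreover have "S\<^sup>2 - 2 * S * e \<le> (r x)\<^sup>2"
    proof -
      \<comment> \<open>The square is bounded by its tangent at \<open>S\<close>, since squaring
        \<open>S - e \<le> r x\<close> would fail when \<open>S < e\<close>.\<close>
      have "S * (S - e) \<le> S * r x" using that(2) S(1) by (intro mult_left_mono)
      moreover have "(r x)\<^sup>2 = (r x - S)\<^sup>2 + 2 * (S * r x) - S\<^sup>2"
        by (simp add: power2_eq_square algebra_simps)
      moreover have "(r x - S)\<^sup>2 \<ge> 0" by simp
      ultimately show ?thesis by (simp add: power2_eq_square algebra_simps)
    qed
    moreover have "c * r x \<le> c * (S + e)"
      using X(3)[OF that(1)] \<open>c > 0\<close> by (intro mult_left_mono) auto
    ultimately show ?thesis unfolding H_def h_def distrib_left by linarith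
  qed
  \<comment> \<open>Backward growth breaks the cap \<open>S + e\<close> that holds left of
    \<open>X\<close>.\<close>
  have "\<exists>x\<le>x0. S + e < r x"
    by (rule unbounded_backward[OF rder x0(2) e(1)]) (use x0(1) r'_le in auto)
  then show False using X(3) x0(1) by (meson not_le order_trans)
qed

section \<open>Reduction of the theorem to nondecreasing profiles\<close>

theorem theorem2p19:
  fixes d K c m M :: real and b b' \<tau> \<tau>' :: "real \<Rightarrow> real"
  assumes "d > 0" and "K > 0"
    and "birth_function d K b"
    and "delay_function \<tau> \<tau>' m M"
    and "monotone_birth d K b b'"
    and "0 < c" and "c < c_star d (b' 0) m"
  shows "\<not> (\<exists>\<phi> :: real \<Rightarrow> real. C2 \<phi> \<and> (mono \<phi> \<or> antimono \<phi>) \<and>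
     (\<forall>\<xi>. deriv (deriv \<phi>) \<xi> - c * deriv \<phi> \<xi> - d * \<phi> \<xi> + b (\<phi> (\<xi> - c * \<tau> (\<phi> \<xi>))) = 0) \<and>
     (\<phi> \<longlongrightarrow> 0) at_bot \<and> (\<phi> \<longlongrightarrow> K) at_top)"
proof
  assume "\<exists>\<phi> :: real \<Rightarrow> real. C2 \<phi> \<and> (mono \<phi> \<or> antimono \<phi>) \<and>
     (\<forall>\<xi>. deriv (deriv \<phi>) \<xi> - c * deriv \<phi> \<xi> - d * \<phi> \<xi> + b (\<phi> (\<xi> - c * \<tau> (\<phi> \<xi>))) = 0) \<and>
     (\<phi> \<longlongrightarrow> 0) at_bot \<and> (\<phi> \<longlongrightarrow> K) at_top"
  then obtain \<phi> :: "real \<Rightarrow> real" where C2: "C2 \<phi>" and mono: "mono \<phi> \<or> antimono \<phi>"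
    and eq: "\<And>x. deriv (deriv \<phi>) x - c * deriv \<phi> x - d * \<phi> x + b (\<phi> (x - c * \<tau> (\<phi> x))) = 0"
    and lim: "(\<phi> \<longlongrightarrow> 0) at_bot" "(\<phi> \<longlongrightarrow> K) at_top"
    by blast
  have "\<not> antimono \<phi>"
  proof
    assume "antimono \<phi>"
    have "\<phi> x \<le> 0" for x
      using lim(1) by (rule tendsto_lowerbound)
        (auto intro!: eventually_mono[OF eventually_le_at_bot[of x]] antimonoD[OF \<open>antimono \<phi>\<close>])
    then have "K \<le> 0" by (intro tendsto_upperbound[OF lim(2)]) auto
    then show False using \<open>K > 0\<close> by simp
  qed
  with mono have "mono \<phi>" by simp
  have p: "b' 0 > d" and m: "0 \<le> m" "\<tau> 0 = m" "\<And>u. u \<ge> 0 \<Longrightarrow> \<tau> u \<ge> 0"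
    using assms by (auto simp: monotone_birth_def delay_function_def)
  obtain L where L: "\<And>u. 0 < u \<Longrightarrow> u \<le> K \<Longrightarrow> b' 0 * u - b u < L * u\<^sup>2"
    using assms(5) unfolding monotone_birth_def by (meson greaterThanAtMost_iff)
  have \<tau>cont: "continuous_on {0..} \<tau>"
    using assms(4) by (auto simp: delay_function_def C1_on_def intro: DERIV_continuous_on)
  \<comment> \<open>Positivity is wanted at every \<open>s \<ge> 0\<close> because the upper limit
    \<open>S\<close> is not known in advance.\<close>
  have char: "char_fun d (b' 0) m s c > 0" if "s \<ge> 0" for s
    using is_critical_speed_c_star[OF \<open>d > 0\<close> p m(1)] assms(6,7) that
    by (simp add: is_critical_speed_def)
  show False
  proof (rule no_mono_profile[where \<phi> = \<phi> and c = c and d = d and b = b and \<tau> = \<tau> and L = L])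
    show "(\<phi> has_real_derivative deriv \<phi> x) (at x)"
      "(deriv \<phi> has_real_derivative deriv (deriv \<phi>) x) (at x)" for x
      using C2 by (auto simp: C2_def DERIV_deriv_iff_real_differentiable)
    show "0 \<le> b u" if "u \<ge> 0" for u
      using assms(3) that by (simp add: birth_function_def)
    show "b' 0 * u - b u \<le> L * u\<^sup>2" if "0 < u" "u \<le> K" for u
      using L[OF that] by simp
  qed (use assms p m \<tau>cont char \<open>mono \<phi>\<close> eq lim in auto)
qed

end
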